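(* Let $m,n$ be positive integers and let $K_{m,n}$ be the complete bipartite graph with parts of sizes $m$ and $n$. Then \[\beta(F_2(K_{m,n}))=\max\Big\{mn,\ \binom{m+n}{2}-mn\Big\}.\]
   Context: For a simple finite graph $G$, the $2$-token graph $F_2(G)$ is the graph whose vertices are all $2$-element subsets of $V(G)$, two such subsets being adjacent iff their symmetric difference is an edge of $G$. $\beta(H)$ denotes the independence number of a graph $H$ (the maximum size of a set of pairwise non-adjacent vertices). *)

theory Defs
  imports "Graph_Theory.Graph_Theory"
begin

text \<open>
  Finite simple graphs are the symmetric, loop-free, multi-arc-free finite digraphs of locale
  \<^locale>\<open>graph\<close>; \<open>{u, v}\<close> is an edge iff \<open>u \<rightarrow>\<^bsub>G\<^esub> v\<close> (equivalently \<open>v \<rightarrow>\<^bsub>G\<^esub> u\<close>).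
\<close>

definition two_token_graph :: "('a, 'b) pre_digraph \<Rightarrow> 'a set pair_pre_digraph" where
  "two_token_graph G =
     \<lparr> pverts = {A. A \<subseteq> verts G \<and> card A = 2},
       parcs = {(A, B). A \<subseteq> verts G \<and> card A = 2 \<and> B \<subseteq> verts G \<and> card B = 2 \<and>
                  (\<exists>u v. u \<rightarrow>\<^bsub>G\<^esub> v \<and> sym_diff A B = {u, v})} \<rparr>"

definition independent_set :: "('a, 'b) pre_digraph \<Rightarrow> 'a set \<Rightarrow> bool" where
  "independent_set H S \<longleftrightarrow> S \<subseteq> verts H \<and> pairwise (\<lambda>u v. \<not> u \<rightarrow>\<^bsub>H\<^esub> v) S"

definition independence_number :: "('a, 'b) pre_digraph \<Rightarrow> nat" where
  "independence_number H = Max {card S | S. independent_set H S}"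

lemma pair_graph_two_token_graph:
  assumes "graph G"
  shows "pair_graph (two_token_graph G)"
proof -
  interpret graph G by fact
  let ?F = "two_token_graph G"
  have fin: "finite (pverts ?F)"
    by (rule finite_subset[of _ "Pow (verts G)"]) (auto simp: two_token_graph_def)
  show ?thesis
  proof
    show "finite (parcs ?F)"
      by (rule finite_subset[of _ "pverts ?F \<times> pverts ?F"])
        (use fin in \<open>auto simp: two_token_graph_def\<close>)
    show "symmetric (with_proj ?F)"
      by (auto simp: symmetric_def two_token_graph_def Un_commute intro!: symI) blast
  qed (use fin in \<open>auto simp: two_token_graph_def\<close>)
qed

text \<open>The set in \<open>independence_number\<close> is finite and nonempty, so \<^const>\<open>Max\<close> is a true maximum.\<close>

lemma independence_number_welldefined:
  assumes "finite (verts H)"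
  shows "finite {card S | S. independent_set H S}" "{card S | S. independent_set H S} \<noteq> {}"
proof -
  have "{card S | S. independent_set H S} \<subseteq> card ` Pow (verts H)"
    by (auto simp: independent_set_def)
  then show "finite {card S | S. independent_set H S}"
    using assms by (meson finite_Pow_iff finite_imageI finite_subset)
  have "independent_set H {}" by (simp add: independent_set_def)
  then show "{card S | S. independent_set H S} \<noteq> {}" by blast
qed

text \<open>Natural-number subtraction in \<open>(m + n choose 2) - m * n\<close> does not truncate.\<close>

lemma mult_le_choose_two: "m * n \<le> (m + n) choose 2"
  by (induction m) (auto simp: numeral_2_eq_2)

end

theory Submission
  imports Defs
begin

text \<open>
  Let \<open>U\<close>, \<open>V\<close> be the parts of the complete bipartite graph. The mixed pairs \<open>{u, v}\<close> with
  \<open>u \<in> U\<close>, \<open>v \<in> V\<close> form one side of a bipartition of the token graph and the pairs inside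
  \<open>U\<close> or inside \<open>V\<close> the other, which gives the lower bound. Conversely, let \<open>R\<close> and \<open>C\<close>
  be the sets of vertices of \<open>U\<close> and \<open>V\<close> occurring in mixed pairs of an independent set. Then
  the remaining members of the set are pairs inside \<open>U - R\<close> or inside \<open>V - C\<close>, so with
  \<open>r = |R|\<close> and \<open>c = |C|\<close> the size is at most
  \<open>r c + (m - r choose 2) + (n - c choose 2)\<close>. This is convex in each of \<open>r\<close> and \<open>c\<close>, so it is
  maximal at a corner of \<open>[0, m] \<times> [0, n]\<close>, and the corners give the bound.
\<close>

lemma choose_two_add: "((m + n) choose 2) = (m choose 2) + (n choose 2) + m * n"
  by (induction m) (auto simp: numeral_2_eq_2)

text \<open>Doubling avoids division, and passing to \<open>int\<close> keeps \<open>n - 1\<close>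
  from truncating at \<open>n = 0\<close>.\<close>

lemma two_mult_choose_two_int: "2 * int (n choose 2) = int n * (int n - 1)"
  by (induction n) (auto simp: numeral_2_eq_2 algebra_simps)

lemma mult_add_choose_two_le_max:
  assumes "r \<le> m"
  shows "r * c + ((m - r) choose 2) \<le> max (m choose 2) (m * c)"
proof -
  define d where "d = m - r"
  have m: "m = r + d"
    using assms by (simp add: d_def)
  have "r * c + (d choose 2) \<le> m * c \<or> r * c + (d choose 2) \<le> m choose 2"
  \<comment> \<open>Twice the gap below \<open>m choose 2\<close> is
    \<open>r * (r + 2 * d - 1 - 2 * c)\<close>, and twice the gap below \<open>m * c\<close> is
    \<open>d * (2 * c + 1 - d)\<close>. If the second factor of the former is negative, that of the
    latter is positive.\<close>
  proof (cases "2 * c + 1 \<le> r + 2 * d")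
    case False
    have "int d * (int d - 1) \<le> int d * (2 * int c)"
      by (rule mult_left_mono) (use False in auto)
    then have "2 * int (r * c + (d choose 2)) \<le> 2 * int (m * c)"
      using two_mult_choose_two_int[of d] by (simp add: m algebra_simps)
    then show ?thesis
      by (simp only: mult_le_cancel_left_pos zero_less_numeral of_nat_le_iff simp_thms)
  next
    case True
    have "int r * (2 * int c) \<le> int r * (int r + 2 * int d - 1)"
      by (rule mult_left_mono) (use True in auto)
    then have "2 * int (r * c + (d choose 2)) \<le> 2 * int (m choose 2)"
      using two_mult_choose_two_int[of d] two_mult_choose_two_int[of m]
      by (simp add: m algebra_simps)
    then show ?thesis
      by (simp only: mult_le_cancel_left_pos zero_less_numeral of_nat_le_iff simp_thms)
  qed
  then show ?thesis
    unfolding d_def by linarith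
qed

text \<open>First move \<open>r\<close> to an end of its range with \<open>c\<close> fixed. At
  \<open>r = 0\<close> the last term only grows when \<open>c\<close> drops to 0; at
  \<open>r = m\<close> the one-variable bound applies again with the roles of the parts
  exchanged.\<close>

lemma mult_add_choose_two_add_choose_two_le_max:
  assumes "r \<le> m" "c \<le> n"
  shows "r * c + ((m - r) choose 2) + ((n - c) choose 2)
           \<le> max (m * n) ((m choose 2) + (n choose 2))"
proof -
  have "(n - c) choose 2 \<le> n choose 2"
    by (rule binomial_right_mono) simp
  moreover have "m * c + ((n - c) choose 2) \<le> max (n choose 2) (m * n)"
    using mult_add_choose_two_le_max[OF assms(2), of m]
    by (simp add: mult.commute)
  ultimately show ?thesis
    using mult_add_choose_two_le_max[OF assms(1), of c] by linarith
qed

text \<open>For the parts of a complete bipartite graph this is also its edge set, as unordered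
  pairs.\<close>

definition mixed_pairs :: "'a set \<Rightarrow> 'a set \<Rightarrow> 'a set set" where
  "mixed_pairs U V = (\<lambda>(u, v). {u, v}) ` (U \<times> V)"

definition pairs_within :: "'a set \<Rightarrow> 'a set set" where
  "pairs_within U = {A. A \<subseteq> U \<and> card A = 2}"

lemma card_mixed_pairs:
  assumes "U \<inter> V = {}"
  shows "card (mixed_pairs U V) = card U * card V"
proof -
  have "inj_on (\<lambda>(u, v). {u, v}) (U \<times> V)"
    using assms by (auto simp: inj_on_def doubleton_eq_iff)
  then show ?thesis
    by (simp add: mixed_pairs_def card_image card_cartesian_product)
qed

lemma card_pairs_within: "finite U \<Longrightarrow> card (pairs_within U) = (card U choose 2)"
  by (simp add: pairs_within_def n_subsets)

lemma finite_pairs_within: "finite U \<Longrightarrow> finite (pairs_within U)"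
  by (simp add: pairs_within_def)

lemma finite_mixed_pairs: "finite U \<Longrightarrow> finite V \<Longrightarrow> finite (mixed_pairs U V)"
  by (simp add: mixed_pairs_def)

lemma pairs_within_Un:
  assumes "U \<inter> V = {}"
  shows "pairs_within (U \<union> V) = mixed_pairs U V \<union> (pairs_within U \<union> pairs_within V)"
proof (intro equalityI subsetI)
  fix A assume "A \<in> pairs_within (U \<union> V)"
  then obtain x y where "A = {x, y}" "x \<noteq> y" "x \<in> U \<union> V" "y \<in> U \<union> V"
    by (auto simp: pairs_within_def card_2_iff)
  then show "A \<in> mixed_pairs U V \<union> (pairs_within U \<union> pairs_within V)"
    by (auto simp: pairs_within_def mixed_pairs_def insert_commute)
next
  fix A assume "A \<in> mixed_pairs U V \<union> (pairs_within U \<union> pairs_within V)"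
  moreover have "card {x, y} = 2" if "x \<in> U" "y \<in> V" for x y
    using that assms by (auto simp: card_insert_if)
  ultimately show "A \<in> pairs_within (U \<union> V)"
    by (auto simp: pairs_within_def mixed_pairs_def)
qed

lemma two_token_graph_adj_iff:
  assumes "arcs_ends G = U \<times> V \<union> V \<times> U" "verts G = U \<union> V"
  shows "A \<rightarrow>\<^bsub>with_proj (two_token_graph G)\<^esub> B \<longleftrightarrow>
     A \<in> pairs_within (U \<union> V) \<and> B \<in> pairs_within (U \<union> V) \<and> sym_diff A B \<in> mixed_pairs U V"
proof -
  have "(\<exists>u v. u \<rightarrow>\<^bsub>G\<^esub> v \<and> X = {u, v}) \<longleftrightarrow> X \<in> mixed_pairs U V" for X
    unfolding assms(1) mixed_pairs_def by (auto simp: insert_commute)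
  then show ?thesis
    unfolding with_proj_simps two_token_graph_def pairs_within_def assms(2)
    by (simp add: conj_ac)
qed

text \<open>Each of \<open>A\<close> and \<open>B\<close> meets \<open>U\<close> in one point, so
  their symmetric difference meets \<open>U\<close> in 0 or 2 points, whereas a mixed pair meets it
  in exactly one.\<close>

lemma sym_diff_mixed_pairs:
  assumes "U \<inter> V = {}" "A \<in> mixed_pairs U V" "B \<in> mixed_pairs U V"
  shows "sym_diff A B \<notin> mixed_pairs U V"
proof
  assume "sym_diff A B \<in> mixed_pairs U V"
  then obtain u v where uv: "u \<in> U" "v \<in> V" "sym_diff A B = {u, v}"
    by (auto simp: mixed_pairs_def)
  obtain a b where a: "a \<in> U" "A \<inter> U = {a}" and b: "b \<in> U" "B \<inter> U = {b}"
    using assms by (fastforce simp: mixed_pairs_def)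
  have "sym_diff {a} {b} = sym_diff A B \<inter> U"
    using a b by blast
  also have "\<dots> = {u}"
    using uv assms(1) by auto
  finally show False
    by (cases "a = b") auto
qed

lemma sym_diff_pairs_within:
  assumes "U \<inter> V = {}" "A \<in> pairs_within U \<union> pairs_within V" "B \<in> pairs_within U \<union> pairs_within V"
  shows "sym_diff A B \<notin> mixed_pairs U V"
proof
  assume "sym_diff A B \<in> mixed_pairs U V"
  then obtain u v where uv: "u \<in> U" "v \<in> V" "sym_diff A B = {u, v}"
    by (auto simp: mixed_pairs_def)
  show False
  \<comment> \<open>Disjoint pairs have a symmetric difference of four elements; intersecting ones
    lie in the same part, and so does their symmetric difference.\<close>
  proof (cases "A \<inter> B = {}")
    case True
    have "card A = 2" "card B = 2"
      using assms by (auto simp: pairs_within_def)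
    then have "card (A \<union> B) = 4"
      using True by (subst card_Un_disjoint) (auto intro: card_ge_0_finite)
    moreover have "A \<union> B = {u, v}"
      using True uv by blast
    ultimately show False
      by (simp add: card_insert_if split: if_splits)
  next
    case False
    then have "A \<union> B \<subseteq> U \<or> A \<union> B \<subseteq> V"
      using assms by (auto simp: pairs_within_def)
    then show False
      using uv assms(1) by blast
  qed
qed

lemma card_independent_two_token_le:
  assumes G: "arcs_ends G = U \<times> V \<union> V \<times> U" "verts G = U \<union> V"
    and UV: "U \<inter> V = {}" "finite U" "finite V"
    and S: "independent_set (with_proj (two_token_graph G)) S"
  shows "card S \<le> max (card U * card V) ((card U choose 2) + (card V choose 2))"
proof -
  define R where "R = {u \<in> U. \<exists>v \<in> V. {u, v} \<in> S}"
  define C where "C = {v \<in> V. \<exists>u \<in> U. {u, v} \<in> S}"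
  have sub: "R \<subseteq> U" "C \<subseteq> V"
    by (auto simp: R_def C_def)
  then have fin: "finite R" "finite C"
    using UV finite_subset by blast+
  have SP: "S \<subseteq> pairs_within (U \<union> V)"
    using S G by (auto simp: independent_set_def two_token_graph_def pairs_within_def)
  have ind: "sym_diff A B \<notin> mixed_pairs U V" if "A \<in> S" "B \<in> S" for A B
  proof (cases "A = B")
    \<comment> \<open>Independence constrains only distinct members; here the symmetric difference
      is empty.\<close>
    case True
    then show ?thesis by (auto simp: mixed_pairs_def)
  next
    case False
    then have "\<not> A \<rightarrow>\<^bsub>with_proj (two_token_graph G)\<^esub> B"
      using S that by (auto simp: independent_set_def pairwise_def)
    then show ?thesis
      using that SP unfolding two_token_graph_adj_iff[OF G] by blast
  qed
  have U_part: "x \<notin> R" if A: "A \<in> S" "A \<in> pairs_within U" "x \<in> A" for x A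
  proof
    assume "x \<in> R"
    then obtain v where v: "v \<in> V" "{x, v} \<in> S" by (auto simp: R_def)
    obtain y where y: "A = {x, y}" "y \<noteq> x" "y \<in> U"
      using A by (fastforce simp: pairs_within_def card_2_iff)
    \<comment> \<open>The two members of \<open>S\<close> share only \<open>x\<close>, so exchanging
      \<open>y\<close> for \<open>v\<close> moves a token along an edge and they would be
      adjacent.\<close>
    have "sym_diff A {x, v} = {y, v}"
      using y v UV A by (auto simp: pairs_within_def)
    then show False
      using ind[OF A(1) v(2)] y v by (auto simp: mixed_pairs_def)
  qed
  have V_part: "x \<notin> C" if A: "A \<in> S" "A \<in> pairs_within V" "x \<in> A" for x A
  proof
    assume "x \<in> C"
    then obtain u where u: "u \<in> U" "{u, x} \<in> S" by (auto simp: C_def)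
    obtain y where y: "A = {x, y}" "y \<noteq> x" "y \<in> V"
      using A by (fastforce simp: pairs_within_def card_2_iff)
    have "sym_diff A {u, x} = {u, y}"
      using y u UV A by (auto simp: pairs_within_def)
    then show False
      using ind[OF A(1) u(2)] y u by (auto simp: mixed_pairs_def)
  qed
  have "S \<subseteq> mixed_pairs R C \<union> (pairs_within (U - R) \<union> pairs_within (V - C))"
  proof
    fix A assume A: "A \<in> S"
    then consider "A \<in> mixed_pairs U V" | "A \<in> pairs_within U" | "A \<in> pairs_within V"
      using SP pairs_within_Un[OF UV(1)] by auto
    then show "A \<in> mixed_pairs R C \<union> (pairs_within (U - R) \<union> pairs_within (V - C))"
    proof cases
      case 1
      then show ?thesis
        using A by (auto simp: mixed_pairs_def R_def C_def)
    next
      case 2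
      then show ?thesis
        using U_part[OF A 2] by (auto simp: pairs_within_def)
    next
      case 3
      then show ?thesis
        using V_part[OF A 3] by (auto simp: pairs_within_def)
    qed
  qed
  then have "card S \<le> card (mixed_pairs R C \<union> (pairs_within (U - R) \<union> pairs_within (V - C)))"
    using UV fin by (intro card_mono) (auto simp: finite_mixed_pairs finite_pairs_within)
  also have "\<dots> \<le> card (mixed_pairs R C) + (card (pairs_within (U - R)) + card (pairs_within (V - C)))"
    by (meson card_Un_le add_left_mono order_trans)
  also have "\<dots> = card R * card C + ((card U - card R) choose 2) + ((card V - card C) choose 2)"
  proof -
    have "R \<inter> C = {}" using sub UV by blast
    then show ?thesis
      using UV fin sub by (simp add: card_mixed_pairs card_pairs_within card_Diff_subset)
  qed
  also have "\<dots> \<le> max (card U * card V) ((card U choose 2) + (card V choose 2))"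
    using UV sub by (intro mult_add_choose_two_add_choose_two_le_max card_mono)
  finally show ?thesis .
qed

theorem theorem1p2:
  fixes m n :: nat and G :: "('a, 'b) pre_digraph"
  assumes "m > 0" and "n > 0" and "K\<^bsub>m,n\<^esub> G"
  shows "independence_number (with_proj (two_token_graph G))
           = max (m * n) (((m + n) choose 2) - m * n)"
proof -
  let ?F = "with_proj (two_token_graph G)"
  obtain U V where G: "graph G" "arcs_ends G = U \<times> V \<union> V \<times> U" "verts G = U \<union> V"
    and UV: "U \<inter> V = {}" and card: "card U = m" "card V = n"
    using assms(3) unfolding complete_bipartite_digraph_def by blast
  \<comment> \<open>Positive cardinality forces finiteness, since \<open>card\<close> is 0 on
    infinite sets.\<close>
  have fin: "finite U" "finite V"
    using assms card card_ge_0_finite by blast+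
  have vF: "verts ?F = pairs_within (U \<union> V)"
    by (simp add: two_token_graph_def pairs_within_def G)
  then have "finite (verts ?F)"
    using fin by (simp add: finite_pairs_within)
  note wd = independence_number_welldefined[OF this]
  have rhs: "((m + n) choose 2) - m * n = (m choose 2) + (n choose 2)"
    by (simp add: choose_two_add)
  have disj: "pairs_within U \<inter> pairs_within V = {}"
    using UV by (fastforce simp: pairs_within_def card_2_iff)
  have "independent_set ?F (mixed_pairs U V)"
    unfolding independent_set_def vF pairwise_def two_token_graph_adj_iff[OF G(2,3)]
    using pairs_within_Un[OF UV] sym_diff_mixed_pairs[OF UV] by blast
  moreover have "card (mixed_pairs U V) = m * n"
    by (simp add: card_mixed_pairs UV card)
  moreover have "independent_set ?F (pairs_within U \<union> pairs_within V)"
    unfolding independent_set_def vF pairwise_def two_token_graph_adj_iff[OF G(2,3)]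
    using pairs_within_Un[OF UV] sym_diff_pairs_within[OF UV] by blast
  moreover have "card (pairs_within U \<union> pairs_within V) = (m choose 2) + (n choose 2)"
    using fin disj by (simp add: card_Un_disjoint finite_pairs_within card_pairs_within card)
  \<comment> \<open>The larger of the two sides of the bipartition realises the maximum.\<close>
  ultimately have attained:
    "max (m * n) ((m choose 2) + (n choose 2)) \<in> {card S | S. independent_set ?F S}"
    by (smt (verit) max_def mem_Collect_eq)
  show ?thesis
    unfolding independence_number_def rhs
    using card_independent_two_token_le[OF G(2,3) UV fin] attained wd(1) card
    by (intro Max_eqI) auto
qed

end
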